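(* Let $X\subset\mathbb{R}^n$ be a non-empty convex set, $\mathcal{A}\subset\mathbb{R}^n$ a non-empty finite set, and let $\lambda\in\Lambda_X(\mathcal{A},\beta)$ for some $\beta\in\mathcal{A}$. Then $\operatorname{relint}\operatorname{conv}(\operatorname{supp}\lambda)\cap\lambda^+=\emptyset$. Moreover, if $\beta\in\operatorname{conv}(\lambda^+)$, then $\mathcal{A}\lambda=\mathbf{0}$.
   Context: $\mathbb{R}^{\mathcal{A}}$ is the set of real vectors indexed by $\mathcal{A}$. For $\beta\in\mathcal{A}$, $N_\beta=\{\nu\in\mathbb{R}^{\mathcal{A}} : \nu_\alpha\ge 0 \text{ for all }\alpha\in\mathcal{A}\setminus\{\beta\},\ \sum_{\alpha\in\mathcal{A}}\nu_\alpha=0\}$. For $\nu\in\mathbb{R}^{\mathcal{A}}$ write $\mathcal{A}\nu=\sum_{\alpha\in\mathcal{A}}\alpha\,\nu_\alpha\in\mathbb{R}^n$. $\sigma_X(y)=\sup\{y^Tx : x\in X\}$ is the support function. A non-zero vector $\nu^*\in N_\beta$ is an $X$-circuit (sublinear circuit of $\mathcal{A}$ with respect to $X$) if (i) $\sigma_X(-\mathcal{A}\nu^* )<\infty$, and (ii) whenever the map $\nu\mapsto\sigma_X(-\mathcal{A}\nu)$ is linear on a two-dimensional convex cone contained in $N_\beta$ (i.e. is finite there and coincides there with a linear function), $\nu^*$ is not in the relative interior of that cone. An $X$-circuit $\lambda\in N_\beta$ is normalized if $\lambda_\beta=-1$; $\Lambda_X(\mathcal{A},\beta)$ denotes the set of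 normalized $X$-circuits of $\mathcal{A}$ with negative entry at $\beta$. $\operatorname{supp}\lambda=\{\alpha\in\mathcal{A}:\lambda_\alpha\neq0\}$ and $\lambda^+=\{\alpha\in\mathcal{A}:\lambda_\alpha>0\}$. $\operatorname{conv}$ denotes convex hull and $\operatorname{relint}$ relative interior. *)

theory Defs
  imports "HOL-Analysis.Analysis"
begin

text \<open>
  A non-empty finite set \<open>\<A> \<subset> \<real>\<^sup>n\<close> is given as the range of an injective family
  \<open>a :: 'k \<Rightarrow> real^'n\<close> over a finite index type \<open>'k\<close>, so that the space of real vectors
  indexed by \<open>\<A>\<close> is the Euclidean space \<open>real^'k\<close>.  An element \<open>\<beta> \<in> \<A>\<close> is represented
  by its index \<open>b\<close>, that is, \<open>\<beta> = a b\<close>.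
\<close>

definition support_function :: "(real^'n) set \<Rightarrow> real^'n \<Rightarrow> ereal" where
  "support_function X y = (SUP x\<in>X. ereal (y \<bullet> x))"

definition point_combination :: "('k::finite \<Rightarrow> real^'n) \<Rightarrow> real^'k \<Rightarrow> real^'n" where
  "point_combination a \<nu> = (\<Sum>k\<in>UNIV. (\<nu> $ k) *\<^sub>R a k)"

definition N_cone :: "'k::finite \<Rightarrow> (real^'k) set" where
  "N_cone b = {\<nu>. (\<forall>k. k \<noteq> b \<longrightarrow> 0 \<le> \<nu> $ k) \<and> (\<Sum>k\<in>UNIV. \<nu> $ k) = 0}"

definition linear_on_cone :: "(real^'k::finite \<Rightarrow> ereal) \<Rightarrow> (real^'k) set \<Rightarrow> bool" where
  "linear_on_cone f C \<longleftrightarrow> (\<exists>L :: real^'k \<Rightarrow> real. linear L \<and> (\<forall>\<nu>\<in>C. f \<nu> = ereal (L \<nu>)))"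

text \<open>
  The predicate \<^const>\<open>cone\<close> requires closure under all scalars \<open>c \<ge> 0\<close>, so non-empty cones
  contain the origin; cones need not be closed.
\<close>

definition X_circuit ::
  "(real^'n) set \<Rightarrow> ('k::finite \<Rightarrow> real^'n) \<Rightarrow> 'k \<Rightarrow> real^'k \<Rightarrow> bool" where
  "X_circuit X a b \<nu> \<longleftrightarrow>
     \<nu> \<in> N_cone b \<and> \<nu> \<noteq> 0 \<and>
     support_function X (- point_combination a \<nu>) < \<infinity> \<and>
     (\<forall>C. convex C \<and> cone C \<and> aff_dim C = 2 \<and> C \<subseteq> N_cone b \<and>
          linear_on_cone (\<lambda>\<mu>. support_function X (- point_combination a \<mu>)) C
          \<longrightarrow> \<nu> \<notin> rel_interior C)"

definition normalized_circuits ::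
  "(real^'n) set \<Rightarrow> ('k::finite \<Rightarrow> real^'n) \<Rightarrow> 'k \<Rightarrow> (real^'k) set" where
  "normalized_circuits X a b = {l. X_circuit X a b l \<and> l $ b = -1}"

text \<open>Supports are subsets of \<open>\<A>\<close>, i.e. sets of points rather than of indices.\<close>

definition supp :: "('k::finite \<Rightarrow> real^'n) \<Rightarrow> real^'k \<Rightarrow> (real^'n) set" where
  "supp a l = {a k |k. l $ k \<noteq> 0}"

definition pos_supp :: "('k::finite \<Rightarrow> real^'n) \<Rightarrow> real^'k \<Rightarrow> (real^'n) set" where
  "pos_supp a l = {a k |k. l $ k > 0}"

end

theory Submission
  imports Defs
begin

text \<open>
  Let \<open>\<lambda>\<close> be a circuit and let \<open>\<mu>\<close> be a vector supported in \<open>supp \<lambda> \<union> {\<beta>}\<close> with \<open>\<A>\<mu> = 0\<close> and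
  coordinate sum zero.  Moving \<open>\<lambda>\<close> slightly in direction \<open>\<plusminus>\<mu>\<close> neither leaves \<open>N\<^sub>\<beta>\<close> nor changes
  \<open>\<A>\<lambda>\<close>, so the support function is linear on the cone spanned by \<open>\<lambda> \<plusminus> \<epsilon>\<mu>\<close>; as \<open>\<lambda>\<close> is a circuit,
  \<open>\<mu>\<close> must be a multiple of \<open>\<lambda>\<close>.  Both claims apply this to an affine dependence \<open>\<mu>\<close>: a point
  of \<open>\<lambda>\<^sup>+\<close> in the relative interior is a strictly positive convex combination of the whole support,
  and \<open>\<beta> \<in> conv \<lambda>\<^sup>+\<close> is a convex combination of \<open>\<lambda>\<^sup>+\<close>.
\<close>

lemma point_combination_add:
  "point_combination a (u + v) = point_combination a u + point_combination a v"
  by (simp add: point_combination_def algebra_simps sum.distrib)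

lemma point_combination_scaleR:
  "point_combination a (c *\<^sub>R u) = c *\<^sub>R point_combination a u"
  by (simp add: point_combination_def scaleR_sum_right)

lemma point_combination_axis:
  "point_combination a (axis k 1) = a k"
proof -
  have "point_combination a (axis k 1) = (\<Sum>j\<in>UNIV. if j = k then a j else 0)"
    unfolding point_combination_def by (intro sum.cong) (auto simp: axis_def)
  then show ?thesis by simp
qed

lemma sum_axis: "(\<Sum>j\<in>UNIV. axis k (1::real) $ j) = 1"
  by (simp add: axis_def)

text \<open>For positive \<open>s\<close>, bounds for \<open>y\<close> and for
  \<open>s *\<^sub>R y\<close> correspond under multiplication by \<open>s\<close>. Non-emptiness of
  \<open>X\<close> matters at \<open>s = 0\<close>, where an empty supremum would be minus infinity
  instead of 0, and it rules out minus infinity as an upper bound \<open>z\<close>.\<close>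

lemma support_function_scaleR:
  assumes "0 \<le> s" and "X \<noteq> {}" and "support_function X y = ereal r"
  shows "support_function X (s *\<^sub>R y) = ereal (s * r)"
proof (cases "s = 0")
  case True
  then show ?thesis using assms(2) by (simp add: support_function_def flip: zero_ereal_def)
next
  case False
  with assms(1) have s: "0 < s" by simp
  have upper: "y \<bullet> x \<le> r" if "x \<in> X" for x
    using SUP_upper[OF that, of "\<lambda>x. ereal (y \<bullet> x)"] assms(3)
    by (simp add: support_function_def)
  show ?thesis
    unfolding support_function_def
  proof (rule SUP_eqI)
    show "ereal (s *\<^sub>R y \<bullet> x) \<le> ereal (s * r)" if "x \<in> X" for x
      using mult_left_mono[OF upper[OF that] assms(1)] by simp
    fix z assume z: "\<And>x. x \<in> X \<Longrightarrow> ereal (s *\<^sub>R y \<bullet> x) \<le> z"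
    show "ereal (s * r) \<le> z"
    proof (cases z)
      case (real t)
      have "support_function X y \<le> ereal (t / s)"
        unfolding support_function_def
        using z s by (intro SUP_least) (simp add: real pos_le_divide_eq mult.commute)
      then show ?thesis using assms(3) s by (simp add: real pos_le_divide_eq mult.commute)
    qed (use z assms(2) in auto)
  qed
qed

lemma support_function_finite:
  assumes "X \<noteq> {}" and "support_function X y < \<infinity>"
  obtains r where "support_function X y = ereal r"
proof -
  obtain x where "x \<in> X" using assms(1) by blast
  then have "ereal (y \<bullet> x) \<le> support_function X y"
    unfolding support_function_def by (rule SUP_upper)
  with assms(2) that show thesis by (cases "support_function X y") auto
qed

text \<open>Moves convex weights from points to indices, extended by 0 outside \<open>K\<close>, so
  that they form a vector of \<open>real^'k\<close> comparable with circuits. Injectivity of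
  \<open>a\<close> keeps the weight of a point from being counted at several indices.\<close>

lemma convex_hull_image_coefficients:
  fixes a :: "'k::finite \<Rightarrow> real^'n"
  assumes "inj a" and "y \<in> convex hull (a ` K)"
  obtains \<theta> :: "real^'k" where "\<And>k. 0 \<le> \<theta> $ k" "\<And>k. k \<notin> K \<Longrightarrow> \<theta> $ k = 0"
    "(\<Sum>k\<in>UNIV. \<theta> $ k) = 1" "point_combination a \<theta> = y"
proof -
  have "finite (a ` K)" by simp
  with assms(2) obtain u where u: "\<forall>x\<in>a ` K. 0 \<le> u x" "sum u (a ` K) = 1"
    "(\<Sum>x\<in>a ` K. u x *\<^sub>R x) = y"
    by (auto simp: convex_hull_finite)
  have inj: "inj_on a K" using assms(1) by (rule inj_on_subset) simp
  define \<theta> :: "real^'k" where "\<theta> = (\<chi> k. if k \<in> K then u (a k) else 0)"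
  have "(\<Sum>k\<in>UNIV. \<theta> $ k) = (\<Sum>k\<in>K. u (a k))"
    by (simp add: \<theta>_def sum.If_cases)
  moreover have "point_combination a \<theta> = (\<Sum>k\<in>UNIV. if k \<in> K then u (a k) *\<^sub>R a k else 0)"
    unfolding point_combination_def by (intro sum.cong) (auto simp: \<theta>_def)
  ultimately show thesis
    using u by (intro that[of \<theta>]) (auto simp: \<theta>_def sum.reindex[OF inj] sum.If_cases)
qed

text \<open>A relative interior point \<open>y\<close> can be pushed slightly away from the
  barycentre of the points without leaving the hull. Then \<open>y\<close> lies strictly between the
  pushed point and the barycentre, and the barycentre contributes positive weight at every index of
  \<open>K\<close>.\<close>

lemma rel_interior_convex_hull_image_coefficients:
  fixes a :: "'k::finite \<Rightarrow> real^'n"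
  assumes "inj a" and y: "y \<in> rel_interior (convex hull (a ` K))"
  obtains \<theta> :: "real^'k" where "\<And>k. k \<in> K \<Longrightarrow> 0 < \<theta> $ k" "\<And>k. k \<notin> K \<Longrightarrow> \<theta> $ k = 0"
    "(\<Sum>k\<in>UNIV. \<theta> $ k) = 1" "point_combination a \<theta> = y"
proof -
  have "K \<noteq> {}" using y by (auto simp: rel_interior_empty)
  then have card: "0 < real (card K)" by (simp add: card_gt_0_iff)
  define \<delta> :: "real^'k" where "\<delta> = (\<chi> k. if k \<in> K then 1 / real (card K) else 0)"
  have \<delta>_sum: "(\<Sum>k\<in>UNIV. \<delta> $ k) = 1"
    using \<open>K \<noteq> {}\<close> by (simp add: \<delta>_def sum.If_cases)
  have "point_combination a \<delta> = (\<Sum>k\<in>K. (1 / real (card K)) *\<^sub>R a k)"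
  proof -
    have "point_combination a \<delta> = (\<Sum>k\<in>UNIV. if k \<in> K then (1 / real (card K)) *\<^sub>R a k else 0)"
      unfolding point_combination_def by (intro sum.cong) (auto simp: \<delta>_def)
    then show ?thesis by (simp add: sum.If_cases)
  qed
  moreover have "(\<Sum>k\<in>K. (1 / real (card K)) *\<^sub>R a k) \<in> convex hull (a ` K)"
    using card by (intro convex_sum) (auto intro: hull_inc)
  ultimately have c: "point_combination a \<delta> \<in> convex hull (a ` K)" by simp
  obtain e where e: "1 < e"
    "(1 - e) *\<^sub>R point_combination a \<delta> + e *\<^sub>R y \<in> convex hull (a ` K)"
    using convex_rel_interior_iff[of "convex hull (a ` K)" y] y c \<open>K \<noteq> {}\<close> by auto
  then obtain \<phi> :: "real^'k" where \<phi>: "\<And>k. 0 \<le> \<phi> $ k" "\<And>k. k \<notin> K \<Longrightarrow> \<phi> $ k = 0"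
    "(\<Sum>k\<in>UNIV. \<phi> $ k) = 1"
    "point_combination a \<phi> = (1 - e) *\<^sub>R point_combination a \<delta> + e *\<^sub>R y"
    using convex_hull_image_coefficients[OF assms(1) e(2)] by metis
  \<comment> \<open>Solves for \<open>y\<close> in the equation z = (1 - e) c + e y, with c the
    barycentre (weights \<open>\<delta>\<close>) and z the pushed point (weights
    \<open>\<phi>\<close>).\<close>
  define \<theta> where "\<theta> = (1 / e) *\<^sub>R (\<phi> + (e - 1) *\<^sub>R \<delta>)"
  show thesis
  proof (rule that[of \<theta>])
    show "0 < \<theta> $ k" if "k \<in> K" for k
    proof -
      have "0 < (e - 1) * \<delta> $ k" using that e(1) card by (simp add: \<delta>_def)
      then show ?thesis using \<phi>(1)[of k] e(1) by (simp add: \<theta>_def)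
    qed
    show "\<theta> $ k = 0" if "k \<notin> K" for k
      using that \<phi>(2) by (simp add: \<theta>_def \<delta>_def)
    show "(\<Sum>k\<in>UNIV. \<theta> $ k) = 1"
    proof -
      have "(\<Sum>k\<in>UNIV. \<theta> $ k) = (1 / e) * ((\<Sum>k\<in>UNIV. \<phi> $ k) + (e - 1) * (\<Sum>k\<in>UNIV. \<delta> $ k))"
        by (simp add: \<theta>_def sum_distrib_left sum.distrib sum_divide_distrib add_divide_distrib)
      then show ?thesis using e(1) by (simp add: \<phi>(3) \<delta>_sum)
    qed
    have "point_combination a \<theta> = (1 / e) *\<^sub>R (e *\<^sub>R y)"
      unfolding \<theta>_def point_combination_scaleR point_combination_add \<phi>(4)
      by (simp add: algebra_simps)
    then show "point_combination a \<theta> = y" using e(1) by simp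
  qed
qed

lemma N_cone_perturbation_bound:
  fixes l \<mu> :: "real^'k::finite"
  assumes "l \<in> N_cone b" and supp: "\<And>k. k \<noteq> b \<Longrightarrow> l $ k = 0 \<Longrightarrow> \<mu> $ k = 0"
  obtains \<epsilon> where "0 < \<epsilon>" "\<And>k. k \<noteq> b \<Longrightarrow> \<epsilon> * \<bar>\<mu> $ k\<bar> \<le> l $ k"
proof -
  have nonneg: "0 \<le> l $ k" if "k \<noteq> b" for k using assms(1) that by (simp add: N_cone_def)
  \<comment> \<open>Each ratio bounds the step size that keeps one coordinate nonnegative. It is
    positive because \<open>supp\<close> excludes a zero of \<open>l\<close> where
    \<open>\<mu>\<close> is non-zero. The entry 1 covers the case that there are no ratios.\<close>
  define E where "E = insert 1 ((\<lambda>k. l $ k / \<bar>\<mu> $ k\<bar>) ` {k. k \<noteq> b \<and> \<mu> $ k \<noteq> 0})"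
  have E: "finite E" "E \<noteq> {}" by (auto simp: E_def)
  show thesis
  proof (rule that[of "Min E"])
    have "0 < x" if "x \<in> E" for x
      using that nonneg supp by (fastforce simp: E_def order_less_le)
    then show "0 < Min E" using E by simp
    show "Min E * \<bar>\<mu> $ k\<bar> \<le> l $ k" if "k \<noteq> b" for k
    proof (cases "\<mu> $ k = 0")
      case True
      then show ?thesis using nonneg[OF that] by simp
    next
      case False
      then have "Min E \<le> l $ k / \<bar>\<mu> $ k\<bar>" using that E by (intro Min_le) (auto simp: E_def)
      then show ?thesis using False by (simp add: field_simps)
    qed
  qed
qed

text \<open>The defining property of circuits enters only here. The hypothesis \<open>supp\<close>
  asks nothing at \<open>b\<close>, since \<open>N_cone\<close> imposes no sign on that coordinate.
  The factor \<open>c\<close> may be 0.\<close>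

lemma X_circuit_dependence_multiple:
  fixes X :: "(real^'n) set" and a :: "'k::finite \<Rightarrow> real^'n" and l \<mu> :: "real^'k"
  assumes "X \<noteq> {}" and circuit: "X_circuit X a b l"
    and supp: "\<And>k. k \<noteq> b \<Longrightarrow> l $ k = 0 \<Longrightarrow> \<mu> $ k = 0"
    and sum0: "(\<Sum>k\<in>UNIV. \<mu> $ k) = 0" and comb0: "point_combination a \<mu> = 0"
  obtains c where "\<mu> = c *\<^sub>R l"
proof (rule ccontr)
  assume "\<not> thesis"
  with that have indep: "\<mu> \<noteq> c *\<^sub>R l" for c by blast
  have lN: "l \<in> N_cone b" and l0: "l \<noteq> 0"
    and fin: "support_function X (- point_combination a l) < \<infinity>"
    and no_cone: "\<And>C. \<lbrakk>convex C; cone C; aff_dim C = 2; C \<subseteq> N_cone b;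
      linear_on_cone (\<lambda>\<mu>. support_function X (- point_combination a \<mu>)) C\<rbrakk>
      \<Longrightarrow> l \<notin> rel_interior C"
    using circuit by (auto simp: X_circuit_def)
  obtain r where r: "support_function X (- point_combination a l) = ereal r"
    using support_function_finite[OF assms(1) fin] .
  obtain \<epsilon> where \<epsilon>: "0 < \<epsilon>" "\<And>k. k \<noteq> b \<Longrightarrow> \<epsilon> * \<bar>\<mu> $ k\<bar> \<le> l $ k"
    using N_cone_perturbation_bound[OF lN supp] by blast
  \<comment> \<open>Coordinates on the plane spanned by \<open>l\<close> and \<open>\<mu>\<close>,
    with \<open>l\<close> at (1, 0). Convexity, dimension and relative interior can be settled in
    the plane and transported along the injective \<open>f\<close>.\<close>
  define f :: "real \<times> real \<Rightarrow> real^'k" where "f p = fst p *\<^sub>R l + snd p *\<^sub>R \<mu>" for p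
  have lin: "linear f"
    by (rule linearI) (simp_all add: f_def algebra_simps)
  have inj: "inj f"
    unfolding linear_injective_0[OF lin]
  proof (intro allI impI)
    fix p assume p: "f p = 0"
    have "snd p = 0"
    proof (rule ccontr)
      assume nz: "snd p \<noteq> 0"
      have "\<mu> = (1 / snd p) *\<^sub>R (snd p *\<^sub>R \<mu>)" using nz by simp
      also have "snd p *\<^sub>R \<mu> = - (fst p *\<^sub>R l)" using p by (simp add: f_def add_eq_0_iff)
      finally have "\<mu> = (- fst p / snd p) *\<^sub>R l" by simp
      with indep show False by blast
    qed
    then show "p = 0" using p l0 by (simp add: f_def prod_eq_iff)
  qed
  \<comment> \<open>The linear functional required by \<open>linear_on_cone\<close> must be defined
    on the whole space, so the coordinates are read off by a linear left inverse of
    \<open>f\<close>.\<close>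
  obtain g where g: "linear g" "g \<circ> f = id"
    using linear_injective_left_inverse[OF lin inj] by blast
  \<comment> \<open>The planar wedge bounded by the rays through (1, \<open>\<epsilon>\<close>) and
    (1, -\<open>\<epsilon>\<close>); its image is the cone spanned by \<open>l\<close> plus or minus
    \<open>\<epsilon>\<close> times \<open>\<mu>\<close>.\<close>
  define K :: "(real \<times> real) set" where "K = {p. \<bar>snd p\<bar> \<le> \<epsilon> * fst p}"
  have K_nonneg: "0 \<le> fst p" if "p \<in> K" for p
  proof -
    have "0 \<le> \<epsilon> * fst p" using that unfolding K_def by (auto intro: order_trans[OF abs_ge_zero])
    then show ?thesis using \<epsilon>(1) by (simp add: zero_le_mult_iff)
  qed
  have cone: "cone K"
    unfolding cone_def
  proof (intro ballI allI impI)
    fix p and c :: real assume "p \<in> K" "0 \<le> c"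
    then have "c * \<bar>snd p\<bar> \<le> c * (\<epsilon> * fst p)" by (auto simp: K_def intro: mult_left_mono)
    then show "c *\<^sub>R p \<in> K" using \<open>0 \<le> c\<close> by (simp add: K_def abs_mult mult.left_commute)
  qed
  have convex: "convex K"
  proof -
    have "K = {p. (- \<epsilon>, 1) \<bullet> p \<le> 0} \<inter> {p. (- \<epsilon>, -1) \<bullet> p \<le> 0}"
      by (auto simp: K_def inner_prod_def)
    then show ?thesis by (simp add: convex_Int convex_halfspace_le)
  qed
  have "open {p :: real \<times> real. \<bar>snd p\<bar> < \<epsilon> * fst p}"
    by (intro open_Collect_less continuous_intros)
  then have interior: "(1, 0) \<in> interior K"
    by (rule interiorI) (use \<epsilon>(1) in \<open>auto simp: K_def\<close>)
  then have dim: "aff_dim K = 2"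
    using aff_dim_nonempty_interior[of K] by auto
  have N: "f ` K \<subseteq> N_cone b"
  proof
    fix v assume "v \<in> f ` K"
    then obtain p where p: "p \<in> K" "v = f p" by blast
    have "0 \<le> v $ k" if "k \<noteq> b" for k
    proof -
      have "\<bar>snd p * \<mu> $ k\<bar> \<le> (\<epsilon> * fst p) * \<bar>\<mu> $ k\<bar>"
        using p(1) by (auto simp: K_def abs_mult intro: mult_right_mono)
      also have "\<dots> = fst p * (\<epsilon> * \<bar>\<mu> $ k\<bar>)" by simp
      also have "\<dots> \<le> fst p * l $ k"
        using \<epsilon>(2)[OF that] K_nonneg[OF p(1)] by (rule mult_left_mono)
      finally show ?thesis by (simp add: p(2) f_def)
    qed
    moreover have "(\<Sum>k\<in>UNIV. v $ k) = 0"
      using lN sum0 by (simp add: p(2) f_def sum.distrib N_cone_def flip: sum_distrib_left)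
    ultimately show "v \<in> N_cone b" by (simp add: N_cone_def)
  qed
  have "linear_on_cone (\<lambda>\<mu>. support_function X (- point_combination a \<mu>)) (f ` K)"
    unfolding linear_on_cone_def
  proof (intro exI conjI ballI)
    \<comment> \<open>As \<open>\<mu>\<close> contributes nothing to the point combination, the
      support function sees only the \<open>l\<close>-coordinate, and homogeneity multiplies
      \<open>r\<close> by it.\<close>
    show "linear (\<lambda>v. fst (g v) * r)"
      using g(1) by (intro linearI) (simp_all add: linear_add linear_scale algebra_simps)
    fix v assume "v \<in> f ` K"
    then obtain p where p: "p \<in> K" "v = f p" by blast
    have "g v = p" using fun_cong[OF g(2), of p] p(2) by simp
    moreover have "- point_combination a v = fst p *\<^sub>R (- point_combination a l)"
      by (simp add: p(2) f_def point_combination_add point_combination_scaleR comb0)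
    ultimately show "support_function X (- point_combination a v) = ereal (fst (g v) * r)"
      using support_function_scaleR[OF K_nonneg[OF p(1)] assms(1) r] by simp
  qed
  moreover have "l \<in> rel_interior (f ` K)"
  proof -
    have "(1, 0) \<in> rel_interior K"
      using interior interior_subset_rel_interior by blast
    then have "f (1, 0) \<in> f ` rel_interior K" by (rule imageI)
    then show ?thesis
      by (simp add: f_def[of "(1, 0)"] rel_interior_injective_linear_image[OF _ inj]
          linear_conv_bounded_linear[symmetric] lin)
  qed
  moreover have "cone (f ` K)"
    using cone by (auto simp: cone_def linear_scale[OF lin, symmetric])
  ultimately show False
    using no_cone[of "f ` K"] N dim convex lin inj
    by (simp add: aff_dim_injective_linear_image convex_linear_image)
qed

theorem theorem4p1:
  fixes X :: "(real^'n) set"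
    and a :: "'k::finite \<Rightarrow> real^'n"
    and b :: 'k
    and l :: "real^'k"
  assumes "X \<noteq> {}" and "convex X"
    and "inj a"
    and "l \<in> normalized_circuits X a b"
  shows "rel_interior (convex hull (supp a l)) \<inter> pos_supp a l = {} \<and>
         (a b \<in> convex hull (pos_supp a l) \<longrightarrow> point_combination a l = 0)"
proof (intro conjI impI)
  have circuit: "X_circuit X a b l" and lb: "l $ b = -1"
    using assms(4) by (auto simp: normalized_circuits_def)
  show "rel_interior (convex hull (supp a l)) \<inter> pos_supp a l = {}"
  proof (rule ccontr)
    assume "\<not> ?thesis"
    then obtain j where j: "0 < l $ j" "a j \<in> rel_interior (convex hull (supp a l))"
      by (auto simp: pos_supp_def)
    moreover have "supp a l = a ` {k. l $ k \<noteq> 0}" by (auto simp: supp_def)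
    ultimately obtain \<theta> :: "real^'k" where \<theta>: "\<And>k. l $ k \<noteq> 0 \<Longrightarrow> 0 < \<theta> $ k"
      "\<And>k. l $ k = 0 \<Longrightarrow> \<theta> $ k = 0" "(\<Sum>k\<in>UNIV. \<theta> $ k) = 1" "point_combination a \<theta> = a j"
      using rel_interior_convex_hull_image_coefficients[OF assms(3), of "a j" "{k. l $ k \<noteq> 0}"]
      by auto
    \<comment> \<open>The difference of two representations of \<open>a j\<close>: the weights
      \<open>\<theta>\<close> and the unit weight at \<open>j\<close>.\<close>
    define \<mu> where "\<mu> = \<theta> + (- 1) *\<^sub>R axis j 1"
    have comb0: "point_combination a \<mu> = 0"
      unfolding \<mu>_def point_combination_add point_combination_scaleR point_combination_axis \<theta>(4)
      by simp
    have sum0: "(\<Sum>k\<in>UNIV. \<mu> $ k) = 0"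
      using \<theta>(3) sum_axis[of j] by (simp add: \<mu>_def sum_subtractf)
    have "\<mu> $ k = 0" if "l $ k = 0" for k
      using \<theta>(2)[OF that] that j(1) by (auto simp: \<mu>_def axis_def)
    then obtain c where c: "\<mu> = c *\<^sub>R l"
      using X_circuit_dependence_multiple[OF assms(1) circuit _ sum0 comb0] by blast
    have "b \<noteq> j" using lb j(1) by auto
    then have "\<mu> $ b = \<theta> $ b" by (simp add: \<mu>_def axis_def)
    \<comment> \<open>At \<open>b\<close> the dependence has the positive entry of
      \<open>\<theta>\<close>, whereas \<open>l\<close> has -1. At any further index of the support
      both \<open>\<mu>\<close> and \<open>l\<close> would be positive, contradicting this sign; so
      the support of \<open>l\<close> reduces to \<open>b\<close> and \<open>j\<close>.\<close>
    then have "c < 0" using c lb \<theta>(1)[of b] by simp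
    have other: "l $ k = 0" if "k \<noteq> b" "k \<noteq> j" for k
    proof (rule ccontr)
      assume "l $ k \<noteq> 0"
      moreover have "0 \<le> l $ k" using circuit that by (simp add: X_circuit_def N_cone_def)
      ultimately have "c * l $ k < 0" using \<open>c < 0\<close> by (simp add: mult_less_0_iff)
      moreover have "\<mu> $ k = \<theta> $ k" using that by (simp add: \<mu>_def axis_def)
      ultimately show False using c \<theta>(1)[OF \<open>l $ k \<noteq> 0\<close>] by simp
    qed
    have two: "(\<Sum>k\<in>UNIV. h k) = h b + h j" if "\<And>k. k \<noteq> b \<Longrightarrow> k \<noteq> j \<Longrightarrow> h k = 0"
      for h :: "'k \<Rightarrow> 'v::comm_monoid_add"
    proof -
      have "(\<Sum>k\<in>UNIV. h k) = (\<Sum>k\<in>{b, j}. h k)"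
        using that by (intro sum.mono_neutral_right) auto
      then show ?thesis using \<open>b \<noteq> j\<close> by simp
    qed
    \<comment> \<open>With only two entries, -1 at \<open>b\<close> and hence 1 at \<open>j\<close>,
      the point combination of \<open>l\<close> is \<open>a j - a b\<close>. It vanishes because
      \<open>c\<close> is non-zero, so two distinct indices would give the same point.\<close>
    have "(\<Sum>k\<in>UNIV. l $ k) = 0" using circuit by (simp add: X_circuit_def N_cone_def)
    then have "l $ j = 1" using two[of "\<lambda>k. l $ k"] other lb by simp
    moreover have "point_combination a l = 0"
      using comb0 \<open>c < 0\<close> by (simp add: c point_combination_scaleR)
    ultimately have "a b = a j"
      using two[of "\<lambda>k. (l $ k) *\<^sub>R a k"] other lb by (simp add: point_combination_def)
    then show False using assms(3) \<open>b \<noteq> j\<close> by (simp add: inj_eq)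
  qed
  assume "a b \<in> convex hull (pos_supp a l)"
  moreover have "pos_supp a l = a ` {k. 0 < l $ k}" by (auto simp: pos_supp_def)
  ultimately obtain \<theta> :: "real^'k" where \<theta>: "\<And>k. \<not> 0 < l $ k \<Longrightarrow> \<theta> $ k = 0"
    "(\<Sum>k\<in>UNIV. \<theta> $ k) = 1" "point_combination a \<theta> = a b"
    using convex_hull_image_coefficients[OF assms(3), of "a b" "{k. 0 < l $ k}"]
    by (metis mem_Collect_eq)
  \<comment> \<open>Now \<open>a b\<close> is represented in two ways, by weights on the positive
    support and by the unit weight at \<open>b\<close>.\<close>
  define \<mu> where "\<mu> = \<theta> + (- 1) *\<^sub>R axis b 1"
  have comb0: "point_combination a \<mu> = 0"
    unfolding \<mu>_def point_combination_add point_combination_scaleR point_combination_axis \<theta>(3)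
    by simp
  have sum0: "(\<Sum>k\<in>UNIV. \<mu> $ k) = 0"
    using \<theta>(2) sum_axis[of b] by (simp add: \<mu>_def sum_subtractf)
  have "\<mu> $ k = 0" if "k \<noteq> b" "l $ k = 0" for k
    using \<theta>(1)[of k] that by (simp add: \<mu>_def axis_def)
  then obtain c where c: "\<mu> = c *\<^sub>R l"
    using X_circuit_dependence_multiple[OF assms(1) circuit _ sum0 comb0] by blast
  \<comment> \<open>Since \<open>l\<close> is negative at \<open>b\<close>, the weight of
    \<open>\<theta>\<close> there is 0; comparing the entries at \<open>b\<close> forces
    \<open>c = 1\<close>.\<close>
  have "\<mu> $ b = -1" using \<theta>(1)[of b] lb by (simp add: \<mu>_def)
  then have "\<mu> = l" using c lb by simp
  then show "point_combination a l = 0" using comb0 by simp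
qed

end
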